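(* Let $r\geq 1$ be an integer. The product of countably many $r$-Ramsey spaces (with the product topology) is $r$-Ramsey.
   Context: For a set $S$ and a positive integer $r$, $[S]^r$ denotes the set of all $r$-element subsets of $S$. For an infinite set $S\subseteq\mathbb{N}$ and a topological space $X$, a function $f\colon[S]^r\to X$ converges to $p\in X$ if for every neighborhood $U$ of $p$ there is a finite set $F$ such that $f(s)\in U$ for all $s\in[S\setminus F]^r$. A space $X$ is $r$-Ramsey (has the $r$-Ramsey property) if for every function $f\colon[\mathbb{N}]^r\to X$ there are $p\in X$ and an infinite set $B\subseteq\mathbb{N}$ such that $f\restriction[B]^r$ converges to $p$. *)

theory Defs
  imports "HOL-Analysis.Function_Topology" "HOL-Library.Ramsey"
begin

text \<open>
  The library's \<open>[S]\<^bsup>r\<^esup>\<close>, i.e. \<open>nsets S r\<close>, is the set of all \<open>r\<close>-element subsets of \<open>S\<close>.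
  Only the values of \<open>f\<close> on \<open>nsets S r\<close> matter below. Neighborhoods are open neighborhoods,
  as in the library's \<open>limitin\<close>.
\<close>

definition nsets_converges ::
    "'a topology \<Rightarrow> nat \<Rightarrow> (nat set \<Rightarrow> 'a) \<Rightarrow> nat set \<Rightarrow> 'a \<Rightarrow> bool" where
  "nsets_converges X r f S p \<longleftrightarrow>
     p \<in> topspace X \<and>
     (\<forall>U. openin X U \<and> p \<in> U \<longrightarrow> (\<exists>F. finite F \<and> (\<forall>s \<in> nsets (S - F) r. f s \<in> U)))"

definition ramsey_space :: "nat \<Rightarrow> 'a topology \<Rightarrow> bool" where
  "ramsey_space r X \<longleftrightarrow>
     (\<forall>f \<in> nsets (UNIV :: nat set) r \<rightarrow> topspace X.
        \<exists>p \<in> topspace X. \<exists>B. infinite B \<and> nsets_converges X r f B p)"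

end

theory Submission
  imports Defs "HOL-Library.Diagonal_Subsequence"
begin

text \<open>
  Convergence along \<open>[B]\<^bsup>r\<^esup>\<close> depends only on \<open>B\<close> up to finitely many elements, and each factor
  allows every infinite set to be thinned out to one along which that coordinate converges.
  Diagonalizing over the countably many coordinates yields one infinite set that is almost contained
  in all of the thinned-out sets; coordinatewise convergence along it is convergence in the product.
\<close>

text \<open>The finitely many elements of \<open>B - A\<close> can be absorbed into the exceptional
  set. This serves both to pass to subsets and to restore finitely many discarded elements.\<close>

lemma nsets_converges_almost_subset:
  assumes "nsets_converges X r f A p" and "finite (B - A)"
  shows "nsets_converges X r f B p"
  unfolding nsets_converges_def
proof (intro conjI allI impI)
  show "p \<in> topspace X"
    using assms(1) by (simp add: nsets_converges_def)
  fix U assume "openin X U \<and> p \<in> U"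
  then obtain F where F: "finite F" "\<forall>s \<in> nsets (A - F) r. f s \<in> U"
    using assms(1) by (auto simp: nsets_converges_def)
  have "nsets (B - (F \<union> (B - A))) r \<subseteq> nsets (A - F) r"
    by (rule nsets_mono) auto
  then show "\<exists>F. finite F \<and> (\<forall>s \<in> nsets (B - F) r. f s \<in> U)"
    using F assms(2) by (intro exI[of _ "F \<union> (B - A)"]) auto
qed

text \<open>Injectivity makes every \<open>r\<close>-set in the image of \<open>B\<close> that
  avoids the image of \<open>F\<close> come from an \<open>r\<close>-set in \<open>B - F\<close>, so
  the image of \<open>F\<close> serves as exceptional set.\<close>

lemma nsets_converges_image:
  fixes h :: "nat \<Rightarrow> nat"
  assumes "nsets_converges X r (\<lambda>t. f (h ` t)) B p" and "inj h"
  shows "nsets_converges X r f (h ` B) p"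
  unfolding nsets_converges_def
proof (intro conjI allI impI)
  show "p \<in> topspace X"
    using assms(1) by (simp add: nsets_converges_def)
  fix U assume "openin X U \<and> p \<in> U"
  then obtain F where F: "finite F" "\<forall>t \<in> nsets (B - F) r. f (h ` t) \<in> U"
    using assms(1) by (auto simp: nsets_converges_def)
  have "f s \<in> U" if "s \<in> nsets (h ` B - h ` F) r" for s
  proof -
    have "s \<in> nsets (h ` (B - F)) r"
      using that \<open>inj h\<close> by (simp add: image_set_diff)
    then obtain t where "t \<in> nsets (B - F) r" "s = h ` t"
      using nset_image_obtains[of s h "B - F" r] \<open>inj h\<close> by (metis inj_on_subset subset_UNIV)
    then show ?thesis
      using F by simp
  qed
  then show "\<exists>F. finite F \<and> (\<forall>s \<in> nsets (h ` B - F) r. f s \<in> U)"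
    using \<open>finite F\<close> by blast
qed

text \<open>The Ramsey property concerns functions on all of \<open>nsets UNIV r\<close>, so
  \<open>f\<close> is pulled back along \<open>s\<close>; the set \<open>B\<close> found there,
  enumerated increasingly, gives \<open>s'\<close>.\<close>

lemma ramsey_space_subsequence:
  assumes "ramsey_space r X" and f: "f \<in> nsets UNIV r \<rightarrow> topspace X"
    and s: "strict_mono (s :: nat \<Rightarrow> nat)"
  obtains s' :: "nat \<Rightarrow> nat" and p
  where "strict_mono s'" "nsets_converges X r f (range (s \<circ> s')) p"
proof -
  have inj: "inj s"
    using s by (simp add: strict_mono_imp_inj_on)
  then have "s ` t \<in> nsets UNIV r" if "t \<in> nsets UNIV r" for t
    using that by (auto simp: nsets_def card_image inj_on_subset)
  then have "(\<lambda>t. f (s ` t)) \<in> nsets UNIV r \<rightarrow> topspace X"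
    using f by auto
  then obtain p B where B: "infinite B" "nsets_converges X r (\<lambda>t. f (s ` t)) B p"
    using assms(1) unfolding ramsey_space_def by blast
  have "nsets_converges X r f (range (s \<circ> enumerate B)) p"
    using nsets_converges_image[OF B(2) inj] B(1)
    by (simp only: image_comp[symmetric] range_enumerate[OF B(1)])
  then show thesis
    using that strict_mono_enumerate[OF B(1)] by blast
qed

text \<open>A basic neighborhood constrains only finitely many coordinates, so the union of their
  exceptional sets is still finite; the other coordinates need only the codomain of
  \<open>f\<close>.\<close>

lemma nsets_converges_product:
  assumes f: "f \<in> nsets B r \<rightarrow> topspace (product_topology X I)"
    and p: "p \<in> extensional I"
    and conv: "\<And>i. i \<in> I \<Longrightarrow> nsets_converges (X i) r (\<lambda>s. f s i) B (p i)"
  shows "nsets_converges (product_topology X I) r f B p"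
  unfolding nsets_converges_def
proof (intro conjI allI impI)
  show "p \<in> topspace (product_topology X I)"
    using p conv by (auto simp: nsets_converges_def PiE_iff)
  fix U assume "openin (product_topology X I) U \<and> p \<in> U"
  then obtain V where V: "finite {i \<in> I. V i \<noteq> topspace (X i)}"
      "\<And>i. i \<in> I \<Longrightarrow> openin (X i) (V i)" "p \<in> Pi\<^sub>E I V" "Pi\<^sub>E I V \<subseteq> U"
    unfolding openin_product_topology_alt by metis
  have "\<exists>F. finite F \<and> (\<forall>s \<in> nsets (B - F) r. f s i \<in> V i)" if "i \<in> I" for i
    using conv[OF that] V(2)[OF that] V(3) that by (auto simp: nsets_converges_def PiE_iff)
  then obtain F where F: "\<And>i. i \<in> I \<Longrightarrow> finite (F i)"
      "\<And>i s. i \<in> I \<Longrightarrow> s \<in> nsets (B - F i) r \<Longrightarrow> f s i \<in> V i"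
    by metis
  define G where "G = (\<Union>i \<in> {i \<in> I. V i \<noteq> topspace (X i)}. F i)"
  have "f s \<in> U" if s: "s \<in> nsets (B - G) r" for s
  proof -
    have "s \<in> nsets B r"
      using s nsets_mono[of "B - G" B r] by auto
    then have fs: "f s \<in> Pi\<^sub>E I (\<lambda>i. topspace (X i))"
      using f by auto
    have "f s i \<in> V i" if "i \<in> I" for i
    proof (cases "V i = topspace (X i)")
      case True
      then show ?thesis
        using fs that by auto
    next
      case False
      then have "nsets (B - G) r \<subseteq> nsets (B - F i) r"
        using that by (intro nsets_mono) (auto simp: G_def)
      then show ?thesis
        using F(2) that s by blast
    qed
    then have "f s \<in> Pi\<^sub>E I V"
      using fs by (simp add: PiE_iff)
    then show ?thesis
      using V(4) by blast
  qed
  moreover have "finite G"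
    using V(1) F(1) by (auto simp: G_def)
  ultimately show "\<exists>F. finite F \<and> (\<forall>s \<in> nsets (B - F) r. f s \<in> U)"
    by blast
qed

theorem theorem3p4:
  fixes r :: nat and I :: "'i set" and X :: "'i \<Rightarrow> 'a topology"
  assumes "r \<ge> 1"
    and "countable I"
    and "\<And>i. i \<in> I \<Longrightarrow> ramsey_space r (X i)"
  shows "ramsey_space r (product_topology X I)"
  unfolding ramsey_space_def
proof
  fix f assume f: "f \<in> nsets (UNIV :: nat set) r \<rightarrow> topspace (product_topology X I)"
  \<comment> \<open>Indices outside \<open>I\<close> are let through because \<open>from_nat_into\<close> leaves \<open>I\<close> when \<open>I\<close> is empty.\<close>
  define P where "P n s \<longleftrightarrow> (let i = from_nat_into I n in i \<in> I \<longrightarrow>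
      (\<exists>p. nsets_converges (X i) r (\<lambda>t. f t i) (range s) p))" for n and s :: "nat \<Rightarrow> nat"
  \<comment> \<open>The locale asks that any strictly increasing sequence can be thinned to satisfy
    \<open>P n\<close>; it supplies the diagonal sequence \<open>diagseq\<close>.\<close>
  interpret subseqs P
  proof
    fix n and s :: "nat \<Rightarrow> nat" assume s: "strict_mono s"
    show "\<exists>s'. strict_mono s' \<and> P n (s \<circ> s')"
    proof (cases "from_nat_into I n \<in> I")
      case True
      then have "(\<lambda>t. f t (from_nat_into I n)) \<in> nsets UNIV r \<rightarrow> topspace (X (from_nat_into I n))"
        using f by (auto simp: Pi_iff PiE_iff)
      from ramsey_space_subsequence[OF assms(3)[OF True] this s] show ?thesis
        unfolding P_def Let_def by metis
    next
      case False
      then show ?thesis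
        using strict_mono_id by (auto simp: P_def)
    qed
  qed
  let ?B = "range diagseq"
  have "\<exists>p. nsets_converges (X i) r (\<lambda>t. f t i) ?B p" if "i \<in> I" for i
  proof -
    obtain n where n: "from_nat_into I n = i"
      using from_nat_into_surj \<open>countable I\<close> \<open>i \<in> I\<close> by metis
    \<comment> \<open>Requirement \<open>n\<close> is first met at stage \<open>Suc n\<close> of the
      construction, so it is obtained only for the tail of \<open>diagseq\<close> from index
      \<open>Suc n\<close>; this uses that \<open>P\<close> passes to subsequences.\<close>
    have "P n (diagseq \<circ> (+) (Suc n))"
    proof (rule diagseq_holds)
      fix k and s s' :: "nat \<Rightarrow> nat" assume "P k s"
      moreover have "range (s \<circ> s') - range s = {}"
        by auto
      ultimately show "P k (s \<circ> s')"
        unfolding P_def Let_def by (metis nsets_converges_almost_subset finite.emptyI)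
    qed
    then have "\<exists>p. nsets_converges (X i) r (\<lambda>t. f t i) (range (diagseq \<circ> (+) (Suc n))) p"
      unfolding P_def[of n "diagseq \<circ> (+) (Suc n)"] Let_def n using \<open>i \<in> I\<close> by (rule mp)
    then obtain p where
      p: "nsets_converges (X i) r (\<lambda>t. f t i) (range (diagseq \<circ> (+) (Suc n))) p" ..
    \<comment> \<open>The tail misses at most the values at indices up to \<open>n\<close>; for
      \<open>m > n\<close> the offset \<open>m - Suc n\<close> recovers \<open>m\<close>.\<close>
    have "diagseq m \<in> diagseq ` {..n} \<union> range (diagseq \<circ> (+) (Suc n))" for m
      by (cases "m \<le> n") (auto simp: image_iff intro!: exI[of _ "m - Suc n"])
    then have "?B - range (diagseq \<circ> (+) (Suc n)) \<subseteq> diagseq ` {..n}"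
      by blast
    then have "finite (?B - range (diagseq \<circ> (+) (Suc n)))"
      by (rule finite_subset) simp
    then show ?thesis
      using nsets_converges_almost_subset[OF p] by (intro exI)
  qed
  then obtain p where p: "\<And>i. i \<in> I \<Longrightarrow> nsets_converges (X i) r (\<lambda>t. f t i) ?B (p i)"
    by metis
  have "f \<in> nsets ?B r \<rightarrow> topspace (product_topology X I)"
    using f nsets_mono[of ?B UNIV r] by blast
  \<comment> \<open>\<open>p\<close> is arbitrary off \<open>I\<close>, whereas points of the
    product are \<open>undefined\<close> there; hence \<open>restrict\<close>.\<close>
  then have "nsets_converges (product_topology X I) r f ?B (restrict p I)"
    using p by (intro nsets_converges_product) auto
  moreover have "infinite ?B"
    using subseq_diagseq by (simp add: range_inj_infinite strict_mono_imp_inj_on)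
  ultimately show "\<exists>p \<in> topspace (product_topology X I). \<exists>B. infinite B \<and>
      nsets_converges (product_topology X I) r f B p"
    unfolding nsets_converges_def by blast
qed

end
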